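(* For any mean payoff game with Maximizer vertices $V_{\max}=\{v_1,\dots,v_m\}$, the set $\Sigma$ of positional Maximizer strategies that guarantee a nonnegative long-term average outcome from every starting vertex forms an ample set of $U=N^+(v_1)\times N^+(v_2)\times\cdots\times N^+(v_m)$.
   Context: A mean payoff game is played by Maximizer and Minimizer on a finite directed graph $G=(V_{\max}\cup V_{\min},E)$ (with $V_{\max},V_{\min}$ disjoint, and every vertex having at least one outgoing edge), with a weight function $w:E\to\mathbb Z$. A pebble is placed on an initial vertex; at each step the owner of the current vertex chooses an outgoing edge along which the pebble moves, indefinitely. The outcome is the long-term average of the weights of the traversed edges (e.g. $\liminf_{n\to\infty}\frac1n\sum_{k=1}^n w(e_k)$), which Maximizer wants to maximize and Minimizer to minimize. $N^+(v)$ is the set of successors of $v$. A positional Maximizer strategy is a vector $\sigma\in N^+(v_1)\times\cdots\times N^+(v_m)$, meaning that Maximizer moves the pebble to $\sigma_i$ whenever it is on $v_i$. $\Sigma$ is the set of $\sigma$ such that for every starting vertex and all choices of Minimizer, the resulting outcome is $\ge 0$. The sets $N^+(v_i)$ may intersect. For a Cartesian product $U=U_1\times\cdots\times U_m$ of nonempty finite sets, a generalized partition is a tuple $\Lambda=(\alpha_1,\dots,\alpha_m)$ with $\alpha_i$ a partition of $U_i$ into nonempty blocks; it defines a partition of $U$ into the boxes $P^1\times\cdots\times P^m$, $P^i\in\alpha_i$, and the minor-subproduct $M(\Lambda)=M_1\times\cdots\times M_m$, where $M_i$ is the set of blocks of $\alpha_i$. $M(\Lambda)$ is shattered by $S\subseteq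 U$ if $S$ meets every box of the box-partition. A copy of $M(\Lambda)$ is a set $W_1\times\cdots\times W_m$ where $W_i$ consists of exactly one element from each block of $\alpha_i$. $M(\Lambda)$ is strongly shattered by $S$ if $S$ contains a copy of it. $S$ is ample if every minor-subproduct of $U$ shattered by $S$ is strongly shattered by $S$. *)

theory Defs
  imports Complex_Main "HOL-Library.FuncSet" "HOL-Library.Disjoint_Sets"
    "HOL-Library.Extended_Real" "HOL-Library.Liminf_Limsup"
begin

subsection \<open>Ample subsets of a Cartesian product\<close>

text \<open>
  Products \<open>U\<^sub>1 \<times> \<dots> \<times> U\<^sub>m\<close> are rendered as \<^term>\<open>PiE I U\<close>, over an arbitrary index
  set \<open>I\<close> instead of \<open>{1..m}\<close>; a tuple \<open>\<Lambda>\<close> of partitions only matters on \<open>I\<close>.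
\<close>

definition generalized_partition :: "'i set \<Rightarrow> ('i \<Rightarrow> 'a set) \<Rightarrow> ('i \<Rightarrow> 'a set set) \<Rightarrow> bool" where
  "generalized_partition I U \<Lambda> \<longleftrightarrow> (\<forall>i\<in>I. partition_on (U i) (\<Lambda> i))"

text \<open>An element of the minor-subproduct is a choice \<open>P\<close> of one block in each
  coordinate; its box is \<^term>\<open>PiE I P\<close>.\<close>

definition minor_subproduct :: "'i set \<Rightarrow> ('i \<Rightarrow> 'a set set) \<Rightarrow> ('i \<Rightarrow> 'a set) set" where
  "minor_subproduct I \<Lambda> = PiE I \<Lambda>"

definition shattered :: "'i set \<Rightarrow> ('i \<Rightarrow> 'a set set) \<Rightarrow> ('i \<Rightarrow> 'a) set \<Rightarrow> bool" where
  "shattered I \<Lambda> S \<longleftrightarrow> (\<forall>P\<in>minor_subproduct I \<Lambda>. S \<inter> PiE I P \<noteq> {})"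

definition is_copy :: "'i set \<Rightarrow> ('i \<Rightarrow> 'a set set) \<Rightarrow> ('i \<Rightarrow> 'a) set \<Rightarrow> bool" where
  "is_copy I \<Lambda> C \<longleftrightarrow>
     (\<exists>W. C = PiE I W \<and> (\<forall>i\<in>I. W i \<subseteq> \<Union>(\<Lambda> i) \<and> (\<forall>B\<in>\<Lambda> i. \<exists>!x. x \<in> W i \<inter> B)))"

definition strongly_shattered :: "'i set \<Rightarrow> ('i \<Rightarrow> 'a set set) \<Rightarrow> ('i \<Rightarrow> 'a) set \<Rightarrow> bool" where
  "strongly_shattered I \<Lambda> S \<longleftrightarrow> (\<exists>C. is_copy I \<Lambda> C \<and> C \<subseteq> S)"

definition ample :: "'i set \<Rightarrow> ('i \<Rightarrow> 'a set) \<Rightarrow> ('i \<Rightarrow> 'a) set \<Rightarrow> bool" where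
  "ample I U S \<longleftrightarrow>
     S \<subseteq> PiE I U \<and>
     (\<forall>\<Lambda>. generalized_partition I U \<Lambda> \<longrightarrow> shattered I \<Lambda> S \<longrightarrow> strongly_shattered I \<Lambda> S)"

subsection \<open>Mean payoff games\<close>

text \<open>
  Integer weights are subject to no condition, so they are not a parameter of the locale. Below,
  they are given by a total function \<open>w\<close>, of which only the values on \<open>E\<close> matter.
\<close>

locale mean_payoff_game =
  fixes Vmax Vmin :: "'v set" and E :: "('v \<times> 'v) set"
  assumes finite_Vmax: "finite Vmax"
    and finite_Vmin: "finite Vmin"
    and disjoint: "Vmax \<inter> Vmin = {}"
    and edges: "E \<subseteq> (Vmax \<union> Vmin) \<times> (Vmax \<union> Vmin)"
    and out_edge: "\<And>v. v \<in> Vmax \<union> Vmin \<Longrightarrow> \<exists>u. (v, u) \<in> E"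

definition successors :: "('v \<times> 'v) set \<Rightarrow> 'v \<Rightarrow> 'v set" where
  "successors E v = E `` {v}"

definition positional_strategies :: "'v set \<Rightarrow> ('v \<times> 'v) set \<Rightarrow> ('v \<Rightarrow> 'v) set" where
  "positional_strategies Vmax E = PiE Vmax (successors E)"

text \<open>\<open>p n\<close> is the position of the pebble after \<open>n\<close> moves.\<close>

definition play_from :: "('v \<times> 'v) set \<Rightarrow> 'v \<Rightarrow> (nat \<Rightarrow> 'v) \<Rightarrow> bool" where
  "play_from E s p \<longleftrightarrow> p 0 = s \<and> (\<forall>n. (p n, p (Suc n)) \<in> E)"

definition consistent :: "'v set \<Rightarrow> ('v \<Rightarrow> 'v) \<Rightarrow> (nat \<Rightarrow> 'v) \<Rightarrow> bool" where
  "consistent Vmax \<sigma> p \<longleftrightarrow> (\<forall>n. p n \<in> Vmax \<longrightarrow> p (Suc n) = \<sigma> (p n))"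

definition outcome :: "('v \<times> 'v \<Rightarrow> int) \<Rightarrow> (nat \<Rightarrow> 'v) \<Rightarrow> ereal" where
  "outcome w p = liminf (\<lambda>n. ereal ((\<Sum>k<n. real_of_int (w (p k, p (Suc k)))) / real n))"

text \<open>Quantifying over all plays consistent with \<open>\<sigma>\<close> lets Minimizer make arbitrary, possibly
  history-dependent choices.\<close>

definition nonneg_strategies ::
  "'v set \<Rightarrow> 'v set \<Rightarrow> ('v \<times> 'v) set \<Rightarrow> ('v \<times> 'v \<Rightarrow> int) \<Rightarrow> ('v \<Rightarrow> 'v) set" where
  "nonneg_strategies Vmax Vmin E w =
     {\<sigma> \<in> positional_strategies Vmax E.
        \<forall>s\<in>Vmax \<union> Vmin. \<forall>p. play_from E s p \<and> consistent Vmax \<sigma> p \<longrightarrow> 0 \<le> outcome w p}"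

text \<open>The factors of the product of strategies are indeed nonempty and finite.\<close>

lemma (in mean_payoff_game) finite_successors: "finite (successors E v)"
proof (rule finite_subset)
  show "successors E v \<subseteq> Vmax \<union> Vmin"
    using edges by (auto simp: successors_def)
qed (use finite_Vmax finite_Vmin in simp)

lemma (in mean_payoff_game) successors_nonempty:
  "v \<in> Vmax \<Longrightarrow> successors E v \<noteq> {}"
  using out_edge[of v] by (auto simp: successors_def)

end

theory Submission
  imports Defs
begin

text \<open>
  Let Minimizer pick, at every Maximizer vertex, a block of the given partition, from which
  Maximizer then picks the successor. Copies contained in \<open>\<Sigma>\<close> are positional winning strategies of
  Maximizer in this game, and shattering says that no positional strategy of Minimizer wins, so
  the theorem amounts to positional determinacy. This is proved by value iteration, capped
  from above at \<open>0\<close>. With discount factor \<open>l < 1\<close>, a function that does not increase in one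
  iteration step is bounded from below, uniformly in \<open>l\<close>, because Minimizer's best choice of
  blocks is met by a strategy in \<open>\<Sigma>\<close>. Letting \<open>l\<close> tend to \<open>1\<close> bounds the undiscounted
  iterates. These are integral and decreasing, so they become stationary, and a fixed point is a
  potential for the edges chosen by Maximizer.
\<close>

subsection \<open>Capped value iteration\<close>

locale block_game =
  fixes X :: "'v set" and A :: "'v \<Rightarrow> 'v set set" and w :: "'v \<times> 'v \<Rightarrow> int"
  assumes finite_X: "finite X"
    and finite_blocks: "v \<in> X \<Longrightarrow> finite (A v)"
    and blocks_nonempty: "v \<in> X \<Longrightarrow> A v \<noteq> {}"
    and block_subset: "v \<in> X \<Longrightarrow> B \<in> A v \<Longrightarrow> B \<subseteq> X"
    and block_nonempty: "v \<in> X \<Longrightarrow> B \<in> A v \<Longrightarrow> B \<noteq> {}"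
begin

text \<open>Bellman operator of a move in which Minimizer names a block and Maximizer answers inside
  it. The cap acts as Minimizer's option to stop with payoff \<open>0\<close>; it makes the iterates
  from \<open>0\<close> decrease.\<close>

definition step :: "real \<Rightarrow> ('v \<Rightarrow> real) \<Rightarrow> 'v \<Rightarrow> real" where
  "step l V v = min 0 (MIN B\<in>A v. MAX u\<in>B. of_int (w (v, u)) + l * V u)"

definition iterate :: "real \<Rightarrow> nat \<Rightarrow> 'v \<Rightarrow> real" where
  "iterate l n = (step l ^^ n) (\<lambda>_. 0)"

lemma iterate_0 [simp]: "iterate l 0 v = 0"
  and iterate_Suc: "iterate l (Suc n) = step l (iterate l n)"
  by (simp_all add: iterate_def)

lemma finite_block: "v \<in> X \<Longrightarrow> B \<in> A v \<Longrightarrow> finite B"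
  using block_subset finite_X finite_subset by metis

text \<open>Turns the nested minimum and maximum into quantifiers; the witness \<open>u\<close> is
  Maximizer's answer to the block \<open>B\<close>.\<close>

lemma le_step_iff:
  assumes "v \<in> X"
  shows "x \<le> step l V v \<longleftrightarrow> x \<le> 0 \<and> (\<forall>B\<in>A v. \<exists>u\<in>B. x \<le> of_int (w (v, u)) + l * V u)"
proof -
  have "x \<le> (MAX u\<in>B. of_int (w (v, u)) + l * V u)
      \<longleftrightarrow> (\<exists>u\<in>B. x \<le> of_int (w (v, u)) + l * V u)" if "B \<in> A v" for B
    using finite_block[OF assms that] block_nonempty[OF assms that] by (simp add: Max_ge_iff)
  then show ?thesis
    using finite_blocks[OF assms] blocks_nonempty[OF assms]
    by (simp add: step_def Min_ge_iff)
qed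

lemma step_nonpos: "step l V v \<le> 0"
  by (simp add: step_def)

lemma iterate_nonpos: "iterate l n v \<le> 0"
  by (cases n) (simp_all add: iterate_Suc step_nonpos)

text \<open>\<open>B\<close> attains the outer minimum, so it is Minimizer's best block. The guard
  \<open>step l V v < 0\<close> excludes an active cap, where every block may be worth more than
  \<open>0\<close>.\<close>

lemma step_attained:
  assumes "v \<in> X"
  shows "\<exists>B\<in>A v. step l V v < 0 \<longrightarrow> (\<forall>u\<in>B. of_int (w (v, u)) + l * V u \<le> step l V v)"
proof -
  let ?g = "\<lambda>B. MAX u\<in>B. of_int (w (v, u)) + l * V u"
  have "Min (?g ` A v) \<in> ?g ` A v"
    using finite_blocks[OF assms] blocks_nonempty[OF assms] by (intro Min_in) auto
  then obtain B where B: "B \<in> A v" "Min (?g ` A v) = ?g B"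
    by blast
  have "of_int (w (v, u)) + l * V u \<le> ?g B" if "u \<in> B" for u
    using that finite_block[OF assms B(1)] by (intro Max_ge) auto
  with B show ?thesis
    by (intro bexI[of _ B]) (auto simp: step_def min_def)
qed

lemma step_mono:
  assumes "v \<in> X" "0 \<le> l" "\<And>u. u \<in> X \<Longrightarrow> V u \<le> V' u"
  shows "step l V v \<le> step l V' v"
  unfolding le_step_iff[OF assms(1)]
proof (intro conjI ballI step_nonpos)
  fix B assume B: "B \<in> A v"
  obtain u where u: "u \<in> B" "step l V v \<le> of_int (w (v, u)) + l * V u"
    using B le_step_iff[OF assms(1), of "step l V v" l V] by auto
  then have "l * V u \<le> l * V' u"
    using assms block_subset[OF assms(1) B] by (intro mult_left_mono) auto
  with u show "\<exists>u\<in>B. step l V v \<le> of_int (w (v, u)) + l * V' u"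
    by force
qed

lemma iterate_decreasing:
  assumes "v \<in> X" "0 \<le> l"
  shows "iterate l (Suc n) v \<le> iterate l n v"
  using assms(1)
proof (induction n arbitrary: v)
  case 0
  then show ?case by (simp add: iterate_Suc step_nonpos)
next
  case (Suc n)
  then show ?case
    using step_mono[OF Suc.prems assms(2), of "iterate l (Suc n)" "iterate l n"]
    by (simp add: iterate_Suc)
qed

lemma step_Ints:
  assumes "v \<in> X" "\<And>u. u \<in> X \<Longrightarrow> V u \<in> \<int>"
  shows "step 1 V v \<in> \<int>"
proof -
  let ?g = "\<lambda>B. MAX u\<in>B. of_int (w (v, u)) + 1 * V u"
  have g: "?g B \<in> \<int>" if "B \<in> A v" for B
  proof -
    have "?g B \<in> (\<lambda>u. of_int (w (v, u)) + 1 * V u) ` B"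
      using finite_block[OF assms(1) that] block_nonempty[OF assms(1) that]
      by (intro Max_in) auto
    then show ?thesis
      using assms(2) block_subset[OF assms(1) that] by auto
  qed
  have "Min (?g ` A v) \<in> ?g ` A v"
    using finite_blocks[OF assms(1)] blocks_nonempty[OF assms(1)] by (intro Min_in) auto
  with g have "Min (?g ` A v) \<in> \<int>"
    by auto
  then show ?thesis
    by (simp add: step_def min_def)
qed

lemma iterate_Ints: "v \<in> X \<Longrightarrow> iterate 1 n v \<in> \<int>"
  by (induction n arbitrary: v) (simp_all add: iterate_Suc step_Ints)

end

section \<open>Lower bounds and stationarity of the iterates\<close>

text \<open>Against each positional choice \<open>P\<close> of Minimizer, the potential
  \<open>h\<close> certifies that Maximizer's answer \<open>s\<close> never loses more than
  \<open>H\<close> in total. \<open>s\<close> and \<open>h\<close> may depend on \<open>P\<close>,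
  but \<open>H\<close> may not.\<close>

locale nonneg_block_game = block_game +
  fixes H :: real
  assumes choice_potential: "\<And>P. (\<And>v. v \<in> X \<Longrightarrow> P v \<in> A v) \<Longrightarrow>
    \<exists>s h. \<forall>v\<in>X. s v \<in> P v \<and> 0 \<le> h v \<and> h v \<le> H \<and> h (s v) - h v \<le> of_int (w (v, s v))"
begin

text \<open>Let Minimizer's best blocks be answered by \<open>s\<close> with potential
  \<open>h\<close>. Where \<open>V + h\<close> is minimal, one move gives
  \<open>m \<ge> l * m\<close> for the minimum \<open>m\<close>, hence \<open>m \<ge> 0\<close> and
  \<open>V \<ge> - h \<ge> - H\<close>.\<close>

lemma discounted_lower_bound:
  assumes l: "0 \<le> l" "l < 1" and V: "\<And>v. v \<in> X \<Longrightarrow> step l V v \<le> V v" and "v \<in> X"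
  shows "- H \<le> V v"
proof -
  have "\<forall>v\<in>X. \<exists>B. B \<in> A v \<and>
      (step l V v < 0 \<longrightarrow> (\<forall>u\<in>B. of_int (w (v, u)) + l * V u \<le> step l V v))"
    using step_attained by blast
  from bchoice[OF this] obtain P where P: "\<And>v. v \<in> X \<Longrightarrow> P v \<in> A v"
      "\<And>v u. v \<in> X \<Longrightarrow> step l V v < 0 \<Longrightarrow> u \<in> P v \<Longrightarrow>
        of_int (w (v, u)) + l * V u \<le> step l V v"
    by blast
  obtain s h where sh: "\<forall>v\<in>X. s v \<in> P v \<and> 0 \<le> h v \<and> h v \<le> H \<and>
      h (s v) - h v \<le> of_int (w (v, s v))"
    using choice_potential[of P, OF P(1)] by blast
  define m where "m = (MIN v\<in>X. V v + h v)"
  have m_le: "m \<le> V u + h u" if "u \<in> X" for u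
    unfolding m_def using that finite_X by (intro Min_le) auto
  have "m \<in> (\<lambda>v. V v + h v) ` X"
    unfolding m_def using finite_X \<open>v \<in> X\<close> by (intro Min_in) auto
  then obtain a where a: "a \<in> X" "m = V a + h a"
    by blast
  have "0 \<le> m"
  proof (cases "0 \<le> V a")
    case True
    then show ?thesis using a sh by auto
  next
    case False
    have sa: "s a \<in> X" "s a \<in> P a"
      using sh a block_subset[OF a(1) P(1)[OF a(1)]] by auto
    \<comment> \<open>As \<open>V a < 0\<close>, the step at \<open>a\<close> lies strictly below
      the cap, so the block \<open>P a\<close> really attains it.\<close>
    have "of_int (w (a, s a)) + l * V (s a) \<le> V a"
      using P(2)[OF a(1) _ sa(2)] V[OF a(1)] False by linarith
    moreover have "h (s a) - h a \<le> of_int (w (a, s a))"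
      using sh a by blast
    moreover have "l * m \<le> l * (V (s a) + h (s a))"
      using l m_le[OF sa(1)] by (intro mult_left_mono)
    moreover have "l * h (s a) \<le> h (s a)"
      using l sh sa(1) by (intro mult_left_le_one_le) auto
    ultimately have "0 \<le> (1 - l) * m"
      using a(2) by (simp add: algebra_simps)
    then show ?thesis
      using l by (simp add: zero_le_mult_iff)
  qed
  then show ?thesis
    using m_le[OF \<open>v \<in> X\<close>] sh \<open>v \<in> X\<close> by force
qed

lemma iterate_discounted_ge:
  assumes "0 \<le> l" "l < 1" "v \<in> X"
  shows "- H \<le> iterate l n v"
  using assms iterate_decreasing[OF _ assms(1), of _ n]
  by (intro discounted_lower_bound[of l]) (auto simp: iterate_Suc)

text \<open>Since discounted iterates are at least \<open>- H\<close>, replacing the factor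
  \<open>l\<close> by \<open>1\<close> loses at most \<open>(1 - l) * H\<close> per step, and the
  losses add up over \<open>n\<close> steps.\<close>

lemma iterate_discounted_le:
  assumes l: "0 \<le> l" "l < 1" and "v \<in> X"
  shows "iterate l n v \<le> iterate 1 n v + n * ((1 - l) * H)"
  using assms(3)
proof (induction n arbitrary: v)
  case 0
  then show ?case by simp
next
  case (Suc n)
  let ?x = "iterate l (Suc n) v" and ?c = "(1 - l) * H"
  have "0 \<le> H"
    using iterate_discounted_ge[OF l Suc.prems, of 0] by simp
  then have c: "0 \<le> ?c"
    using l by (intro mult_nonneg_nonneg) auto
  have "?x - Suc n * ?c \<le> step 1 (iterate 1 n) v"
    unfolding le_step_iff[OF Suc.prems]
  proof (intro conjI ballI)
    have "0 \<le> Suc n * ?c"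
      by (intro mult_nonneg_nonneg[OF _ c]) simp
    then show "?x - Suc n * ?c \<le> 0"
      using iterate_nonpos[of l "Suc n" v] by linarith
  next
    fix B assume B: "B \<in> A v"
    obtain u where u: "u \<in> B" "?x \<le> of_int (w (v, u)) + l * iterate l n u"
      using B le_step_iff[OF Suc.prems, of ?x l "iterate l n"] by (auto simp: iterate_Suc)
    have uX: "u \<in> X"
      using u B block_subset[OF Suc.prems] by blast
    have "(1 - l) * (- H) \<le> (1 - l) * iterate l n u"
      using l iterate_discounted_ge[OF l uX] by (intro mult_left_mono) auto
    with u(2) Suc.IH[OF uX]
    have "?x - Suc n * ?c \<le> of_int (w (v, u)) + 1 * iterate 1 n u"
      by (simp add: algebra_simps)
    with u(1) show "\<exists>u\<in>B. ?x - Suc n * ?c \<le> of_int (w (v, u)) + 1 * iterate 1 n u"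
      by blast
  qed
  then show ?case
    by (simp add: iterate_Suc)
qed

lemma iterate_ge:
  assumes "v \<in> X"
  shows "- 2 * H \<le> iterate 1 n v"
proof -
  \<comment> \<open>Tuned to \<open>n\<close>: the accumulated loss \<open>n * (1 - l) * H\<close>
    is at most \<open>H\<close>, which accounts for the second \<open>H\<close> in the bound.
    \<open>Suc n\<close> also covers \<open>n = 0\<close>.\<close>
  define l where "l = 1 - 1 / real (Suc n)"
  have l: "0 \<le> l" "l < 1"
    by (simp_all add: l_def)
  have "0 \<le> H"
    using iterate_discounted_ge[OF l assms, of 0] by simp
  then have "n * ((1 - l) * H) \<le> H"
    by (simp add: l_def field_simps)
  then show ?thesis
    using iterate_discounted_ge[OF l assms, of n] iterate_discounted_le[OF l assms, of n]
    by linarith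
qed

text \<open>Integral values that decrease strictly drop by at least \<open>1\<close>, so without
  stationarity the sum over \<open>X\<close> would fall below any bound, against
  \<open>iterate_ge\<close>.\<close>

lemma iterate_stationary: "\<exists>n. \<forall>v\<in>X. iterate 1 (Suc n) v = iterate 1 n v"
proof (rule ccontr)
  assume "\<not> ?thesis"
  then have ex: "\<exists>v\<in>X. iterate 1 (Suc n) v \<noteq> iterate 1 n v" for n
    by blast
  have sum_le: "(\<Sum>v\<in>X. iterate 1 n v) \<le> - real n" for n
  proof (induction n)
    case 0
    then show ?case by simp
  next
    case (Suc n)
    obtain a where a: "a \<in> X" "iterate 1 (Suc n) a \<noteq> iterate 1 n a"
      using ex by blast
    then have "iterate 1 (Suc n) a < iterate 1 n a"
      using iterate_decreasing[of a 1 n] by simp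
    moreover obtain i j where "iterate 1 (Suc n) a = of_int i" "iterate 1 n a = of_int j"
      using iterate_Ints[OF a(1)] by (metis Ints_cases)
    ultimately have "iterate 1 (Suc n) a \<le> iterate 1 n a - 1"
      by simp
    moreover have "(\<Sum>v\<in>X - {a}. iterate 1 (Suc n) v) \<le> (\<Sum>v\<in>X - {a}. iterate 1 n v)"
      using iterate_decreasing[of _ 1 n] by (intro sum_mono) auto
    ultimately show ?case
      using Suc.IH sum.remove[OF finite_X a(1), of "iterate 1 (Suc n)"]
        sum.remove[OF finite_X a(1), of "iterate 1 n"] by simp
  qed
  obtain n where n: "card X * (2 * H) < real n"
    using reals_Archimedean2 by blast
  have "(\<Sum>v\<in>X. - 2 * H) \<le> (\<Sum>v\<in>X. iterate 1 n v)"
    using iterate_ge by (intro sum_mono)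
  with n sum_le[of n] show False
    by simp
qed

text \<open>A stationary iterate is a fixed point of \<open>step 1\<close>, and
  \<open>le_step_iff\<close> reads off an answer to every block. Unlike in
  \<open>choice_potential\<close>, a single \<open>V\<close> now serves all choices of blocks;
  \<open>- V\<close> plays the role of \<open>h\<close>.\<close>

theorem uniform_potential:
  obtains r V where "\<And>v B. v \<in> X \<Longrightarrow> B \<in> A v \<Longrightarrow> r v B \<in> B"
    and "\<And>v B. v \<in> X \<Longrightarrow> B \<in> A v \<Longrightarrow> V v \<le> of_int (w (v, r v B)) + V (r v B)"
    and "\<And>v. V v \<le> (0 :: real)"
proof -
  obtain n where n: "\<forall>v\<in>X. iterate 1 (Suc n) v = iterate 1 n v"
    using iterate_stationary by blast
  let ?V = "iterate 1 n"
  have "\<exists>u\<in>B. ?V v \<le> of_int (w (v, u)) + ?V u" if "v \<in> X" "B \<in> A v" for v B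
    using le_step_iff[OF that(1), of "?V v" 1 ?V] n that by (auto simp: iterate_Suc)
  then obtain r where "\<And>v B. v \<in> X \<Longrightarrow> B \<in> A v \<Longrightarrow>
      r v B \<in> B \<and> ?V v \<le> of_int (w (v, r v B)) + ?V (r v B)"
    by metis
  with iterate_nonpos show thesis
    by (intro that[of r ?V]) auto
qed

end

subsection \<open>Potentials and outcomes\<close>

text \<open>The inequalities telescope: all partial sums are at least the constant
  \<open>V (p 0)\<close>, which vanishes on averaging.\<close>

lemma outcome_nonneg_if_potential:
  fixes V :: "'v \<Rightarrow> real"
  assumes "\<And>k. V (p k) \<le> of_int (w (p k, p (Suc k))) + V (p (Suc k))" and "\<And>v. V v \<le> 0"
  shows "0 \<le> outcome w p"
proof -
  let ?S = "\<lambda>n. \<Sum>k<n. real_of_int (w (p k, p (Suc k)))"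
  have "V (p 0) - V (p n) \<le> ?S n" for n
  proof (induction n)
    case (Suc n)
    then show ?case using assms(1)[of n] by simp
  qed simp
  then have le: "V (p 0) \<le> ?S n" for n
    using assms(2)[of "p n"] by (smt (verit))
  have "(\<lambda>n. ereal (V (p 0) / real n)) \<longlonglongrightarrow> ereal 0"
    by (intro tendsto_intros lim_const_over_n)
  then have "liminf (\<lambda>n. ereal (V (p 0) / real n)) = ereal 0"
    by (intro lim_imp_Liminf) simp_all
  then have "0 = liminf (\<lambda>n. ereal (V (p 0) / real n))"
    by (simp only: zero_ereal_def)
  also have "\<dots> \<le> outcome w p"
    unfolding outcome_def by (intro Liminf_mono always_eventually allI) (simp add: le divide_right_mono)
  finally show ?thesis .
qed

section \<open>From nonnegative outcomes back to potentials\<close>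

lemma liminf_average_nonneg_ge:
  fixes S :: "nat \<Rightarrow> real"
  assumes "0 \<le> liminf (\<lambda>n. ereal (S n / real n))" and "0 < e"
  shows "\<exists>N. \<forall>n\<ge>N. - (e * real n) \<le> S n"
proof -
  have "ereal (- e) < liminf (\<lambda>n. ereal (S n / real n))"
    using assms by (intro less_le_trans[OF _ assms(1)]) simp
  then have "eventually (\<lambda>n. ereal (- e) < ereal (S n / real n)) sequentially"
    by (rule less_LiminfD)
  then obtain N where N: "\<And>n. n \<ge> N \<Longrightarrow> - e < S n / real n"
    by (auto simp: eventually_sequentially)
  \<comment> \<open>\<open>Suc N\<close> keeps \<open>n\<close> positive, so that the division by
    \<open>n\<close> can be undone.\<close>
  have "- (e * real n) \<le> S n" if "n \<ge> Suc N" for n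
    using N[of n] that by (simp add: field_simps)
  then show ?thesis by blast
qed

text \<open>From \<open>N\<close> on, each period adds the same \<open>c\<close>. A negative
  \<open>c\<close> would make the sums fall linearly, so \<open>c \<ge> 0\<close> and the minimum
  over the indices up to \<open>N + d\<close> bounds all sums.\<close>

lemma periodic_partial_sums_bounded_below:
  fixes a :: "nat \<Rightarrow> int"
  assumes "0 < d" and periodic: "\<And>k. N \<le> k \<Longrightarrow> a (k + d) = a k"
    and "0 \<le> liminf (\<lambda>n. ereal ((\<Sum>k<n. real_of_int (a k)) / real n))"
  shows "\<exists>C. \<forall>n. - C \<le> (\<Sum>k<n. real_of_int (a k))"
proof -
  define S where "S n = (\<Sum>k<n. real_of_int (a k))" for n
  define c where "c = S (N + d) - S N"
  have S_add: "S (n + d) = S n + c" if "N \<le> n" for n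
    using that
  proof (induction n rule: dec_induct)
    case base
    then show ?case by (simp add: c_def)
  next
    case (step n)
    then show ?case using periodic[of n] by (simp add: S_def)
  qed
  have S_mult: "S (N + j * d) = S N + j * c" for j
  proof (induction j)
    case (Suc j)
    then show ?case using S_add[of "N + j * d"] by (simp add: algebra_simps)
  qed simp
  have "0 \<le> c"
  proof (rule ccontr)
    assume "\<not> 0 \<le> c"
    \<comment> \<open>Half the average loss per index, so the sums fall at twice the rate that
      \<open>e\<close> permits.\<close>
    define e where "e = - c / (2 * d)"
    have e: "0 < e" "e * d = - c / 2"
      using \<open>\<not> 0 \<le> c\<close> \<open>0 < d\<close> by (simp_all add: e_def field_simps)
    obtain M where M: "\<And>n. n \<ge> M \<Longrightarrow> - (e * real n) \<le> S n"
      using liminf_average_nonneg_ge[OF assms(3) e(1)] by (auto simp: S_def)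
    \<comment> \<open>After \<open>j\<close> periods the excess loss outweighs the start value
      \<open>S N + e * N\<close>; the maximum with \<open>M\<close> below also brings the index
      \<open>N + i * d\<close> into the range of the estimate.\<close>
    obtain j where j: "(S N + e * N) / (- c / 2) < real j"
      using reals_Archimedean2 by blast
    define i where "i = max j M"
    have "i \<le> i * d"
      using \<open>0 < d\<close> by simp
    then have "N + i * d \<ge> M"
      by (simp add: i_def)
    then have "- (e * N + i * (e * d)) \<le> S N + i * c"
      using M[of "N + i * d"] S_mult[of i] by (simp add: algebra_simps)
    then have "i * (- c / 2) \<le> S N + e * N"
      unfolding e(2) by (simp add: field_simps)
    moreover have "S N + e * N < j * (- c / 2)"
      using j \<open>\<not> 0 \<le> c\<close> by (simp add: field_simps)
    moreover have "j * (- c / 2) \<le> i * (- c / 2)"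
      using \<open>\<not> 0 \<le> c\<close> by (intro mult_right_mono) (auto simp: i_def)
    ultimately show False by linarith
  qed
  have "Min (S ` {..N + d}) \<le> S n" for n
  proof (induction n rule: less_induct)
    case (less n)
    show ?case
    proof (cases "n \<le> N + d")
      case True
      then show ?thesis by (intro Min_le) auto
    next
      case False
      then have "Min (S ` {..N + d}) \<le> S (n - d)"
        using \<open>0 < d\<close> by (intro less) simp
      then show ?thesis
        using S_add[of "n - d"] False \<open>0 \<le> c\<close> by simp
    qed
  qed
  then show ?thesis
    unfolding S_def by (metis minus_minus)
qed

text \<open>By pigeonhole the orbit returns to an earlier point, and from there it must repeat
  itself.\<close>

lemma orbit_periodic:
  fixes s :: "'a \<Rightarrow> 'a"
  assumes "finite X" "\<And>n. (s ^^ n) v \<in> X"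
  shows "\<exists>N d. 0 < d \<and> (\<forall>k\<ge>N. (s ^^ (k + d)) v = (s ^^ k) v)"
proof -
  have "\<not> inj (\<lambda>n. (s ^^ n) v)"
    using assms by (meson finite_subset finite_imageD image_subsetI infinite_UNIV_nat)
  then obtain i j where "i < j" "(s ^^ i) v = (s ^^ j) v"
    unfolding inj_def by (metis linorder_neqE_nat)
  define d where "d = j - i"
  have "(s ^^ (k + d)) v = (s ^^ k) v" if "k \<ge> i" for k
  proof -
    have "(s ^^ (k + d)) v = (s ^^ (k - i)) ((s ^^ j) v)"
      using that \<open>i < j\<close> funpow_add[of "k - i" j s] by (simp add: d_def)
    also have "\<dots> = (s ^^ k) v"
      using that \<open>(s ^^ i) v = (s ^^ j) v\<close>
      by (metis comp_apply funpow_add le_add_diff_inverse2)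
    finally show ?thesis .
  qed
  with \<open>i < j\<close> show ?thesis
    by (intro exI[of _ i] exI[of _ d]) (simp add: d_def)
qed

text \<open>\<open>h v\<close> is the worst total loss along the orbit of \<open>v\<close>. It is
  finite because the weights are eventually periodic, and nonnegative because of the empty
  sum.\<close>

lemma potential_if_outcome_nonneg:
  assumes "finite X" and s: "\<And>v. v \<in> X \<Longrightarrow> s v \<in> X"
    and nonneg: "\<And>v. v \<in> X \<Longrightarrow> 0 \<le> outcome w (\<lambda>n. (s ^^ n) v)"
  shows "\<exists>h H. \<forall>v\<in>X. 0 \<le> h v \<and> h v \<le> H \<and> h (s v) - h v \<le> real_of_int (w (v, s v))"
proof -
  define S where "S v n = (\<Sum>k<n. real_of_int (w ((s ^^ k) v, (s ^^ Suc k) v)))" for v n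
  define h where "h v = (SUP n. - S v n)" for v
  have orbit: "(s ^^ n) v \<in> X" if "v \<in> X" for v n
    by (induction n) (simp_all add: that s)
  have bdd: "bdd_above (range (\<lambda>n. - S v n))" if v: "v \<in> X" for v
  proof -
    obtain N d where Nd: "0 < d" "\<And>k. N \<le> k \<Longrightarrow> (s ^^ (k + d)) v = (s ^^ k) v"
      using orbit_periodic[OF assms(1) orbit[OF v]] by blast
    have "w ((s ^^ (k + d)) v, (s ^^ Suc (k + d)) v) = w ((s ^^ k) v, (s ^^ Suc k) v)"
      if "N \<le> k" for k
      using Nd(2)[OF that] by simp
    with periodic_partial_sums_bounded_below[OF Nd(1), of N "\<lambda>k. w ((s ^^ k) v, (s ^^ Suc k) v)"]
    obtain C where "\<forall>n. - C \<le> S v n"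
      using nonneg[OF v] unfolding S_def outcome_def by blast
    then show ?thesis
      by (intro bdd_aboveI[of _ C]) (auto simp: minus_le_iff)
  qed
  have "0 \<le> h v" if "v \<in> X" for v
    using cSUP_upper[OF _ bdd[OF that], of 0] by (simp add: h_def S_def)
  moreover have "h v \<le> Max (h ` X)" if "v \<in> X" for v
    using that assms(1) by (intro Max_ge) auto
  moreover have "h (s v) - h v \<le> of_int (w (v, s v))" if "v \<in> X" for v
  proof -
    \<comment> \<open>Prefixing the edge out of \<open>v\<close> turns a segment of the orbit of
      \<open>s v\<close> into one of the orbit of \<open>v\<close>, longer by one.\<close>
    have "- S (s v) n \<le> h v + of_int (w (v, s v))" for n
    proof -
      have "S v (Suc n) = of_int (w (v, s v)) + S (s v) n"
        by (simp add: S_def sum.lessThan_Suc_shift funpow_swap1 del: sum.lessThan_Suc)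
      then show ?thesis
        using cSUP_upper[OF _ bdd[OF that], of "Suc n"] by (simp add: h_def)
    qed
    then have "h (s v) \<le> h v + of_int (w (v, s v))"
      unfolding h_def[of "s v"] by (intro cSUP_least) auto
    then show ?thesis by simp
  qed
  ultimately show ?thesis by blast
qed

section \<open>Ampleness via the block game\<close>

theorem theorem16:
  fixes Vmax Vmin :: "'v set" and E :: "('v \<times> 'v) set" and w :: "'v \<times> 'v \<Rightarrow> int"
  assumes "mean_payoff_game Vmax Vmin E"
  shows "ample Vmax (successors E) (nonneg_strategies Vmax Vmin E w)"
  unfolding ample_def
proof (intro conjI allI impI)
  interpret mean_payoff_game Vmax Vmin E
    by (fact assms)
  let ?\<Sigma> = "nonneg_strategies Vmax Vmin E w"
  show "?\<Sigma> \<subseteq> PiE Vmax (successors E)"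
    by (auto simp: nonneg_strategies_def positional_strategies_def)
  fix \<Lambda>
  assume "generalized_partition Vmax (successors E) \<Lambda>" and shattered: "shattered Vmax \<Lambda> ?\<Sigma>"
  then have partition: "partition_on (successors E v) (\<Lambda> v)" if "v \<in> Vmax" for v
    using that by (simp add: generalized_partition_def)
  define X where "X = Vmax \<union> Vmin"
  \<comment> \<open>Singleton blocks at Minimizer's vertices make the choice of a block there the
    move itself, so all vertices follow one rule.\<close>
  define A where "A v = (if v \<in> Vmax then \<Lambda> v else (\<lambda>u. {u}) ` successors E v)" for v
  have A_Union: "\<Union>(A v) = successors E v" for v
    using partition_onD1[OF partition] by (simp add: A_def)
  have succ_X: "successors E v \<subseteq> X" for v
    using edges by (auto simp: X_def successors_def)
  have succ_nonempty: "successors E v \<noteq> {}" if "v \<in> X" for v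
    using out_edge[of v] that by (auto simp: X_def successors_def)
  interpret block_game X A w
  proof
    show "finite X"
      using finite_Vmax finite_Vmin by (simp add: X_def)
    show "finite (A v)" for v
      using A_Union[of v] finite_successors[of v] by (metis finite_UnionD)
    show "A v \<noteq> {}" if "v \<in> X" for v
      using A_Union[of v] succ_nonempty[OF that] by auto
    show "B \<subseteq> X" if "B \<in> A v" for v B
      using that A_Union[of v] succ_X[of v] by blast
    show "B \<noteq> {}" if "B \<in> A v" for v B
      using that partition_onD3[OF partition, of v] by (auto simp: A_def split: if_splits)
  qed
  define bounded_potential where "bounded_potential H P \<longleftrightarrow>
      (\<exists>s h. \<forall>v\<in>X. s v \<in> P v \<and> 0 \<le> h v \<and> h v \<le> H \<and> h (s v) - h v \<le> real_of_int (w (v, s v)))"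
    for H P
  have potential: "\<exists>H. bounded_potential H P"
    if P: "\<And>v. v \<in> X \<Longrightarrow> P v \<in> A v" for P
  proof -
    have "P v \<in> \<Lambda> v" if "v \<in> Vmax" for v
      using P[of v] that by (simp add: X_def A_def)
    \<comment> \<open>On \<open>Vmax\<close>, Minimizer's choice \<open>P\<close> is a box of the
      partition; shattering puts a nonnegative strategy in it.\<close>
    then have "restrict P Vmax \<in> minor_subproduct Vmax \<Lambda>"
      by (auto simp: minor_subproduct_def)
    then obtain \<sigma> where \<sigma>: "\<sigma> \<in> ?\<Sigma>" "\<sigma> \<in> PiE Vmax (restrict P Vmax)"
      using shattered unfolding shattered_def by blast
    \<comment> \<open>On \<open>Vmin\<close> the block is a singleton, so \<open>SOME\<close>
      returns the move fixed by \<open>P\<close>. The orbits of \<open>s\<close> are thus plays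
      consistent with \<open>\<sigma>\<close>.\<close>
    define s where "s v = (if v \<in> Vmax then \<sigma> v else SOME u. u \<in> P v)" for v
    have sP: "s v \<in> P v" if "v \<in> X" for v
      using \<sigma>(2) block_nonempty[OF that P[OF that]] by (auto simp: s_def some_in_eq PiE_iff)
    have sE: "(v, s v) \<in> E" if "v \<in> X" for v
      using sP[OF that] P[OF that] A_Union[of v] by (auto simp: successors_def)
    have sX: "s v \<in> X" if "v \<in> X" for v
      using sE[OF that] succ_X[of v] by (auto simp: successors_def)
    have "0 \<le> outcome w (\<lambda>n. (s ^^ n) v)" if "v \<in> X" for v
    proof -
      have "(s ^^ n) v \<in> X" for n
        by (induction n) (simp_all add: that sX)
      then have "play_from E v (\<lambda>n. (s ^^ n) v)"
        using sE by (simp add: play_from_def)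
      moreover have "consistent Vmax \<sigma> (\<lambda>n. (s ^^ n) v)"
        by (simp add: consistent_def s_def)
      ultimately show ?thesis
        using \<sigma>(1) that by (auto simp: nonneg_strategies_def X_def)
    qed
    from potential_if_outcome_nonneg[OF finite_X sX this] sP show ?thesis
      unfolding bounded_potential_def by blast
  qed
  \<comment> \<open>Extensional choices of blocks are finite in number, so the largest of their
    bounds serves for all; other choices are restricted to \<open>X\<close> afterwards.\<close>
  obtain H where H: "\<And>P. P \<in> PiE X A \<Longrightarrow> bounded_potential H P"
  proof -
    have "\<forall>P\<in>PiE X A. \<exists>H. bounded_potential H P"
      by (intro ballI potential) (rule PiE_mem)
    then obtain f where f: "\<forall>P\<in>PiE X A. bounded_potential (f P) P"
      by (auto dest: bchoice)
    show thesis
    proof (rule that)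
      fix P assume P: "P \<in> PiE X A"
      have "f P \<le> Max (f ` PiE X A)"
        using P finite_X finite_blocks by (intro Max_ge finite_imageI finite_PiE) auto
      moreover have "bounded_potential (f P) P"
        using f P by blast
      ultimately show "bounded_potential (Max (f ` PiE X A)) P"
        unfolding bounded_potential_def by (meson order_trans)
    qed
  qed
  interpret nonneg_block_game X A w H
  proof
    fix P assume "\<And>v. v \<in> X \<Longrightarrow> P v \<in> A v"
    then have "restrict P X \<in> PiE X A"
      by auto
    from H[OF this] show "\<exists>s h. \<forall>v\<in>X. s v \<in> P v \<and> 0 \<le> h v \<and> h v \<le> H \<and>
        h (s v) - h v \<le> real_of_int (w (v, s v))"
      by (simp add: bounded_potential_def cong: ball_cong)
  qed
  obtain r V where r: "\<And>v B. v \<in> X \<Longrightarrow> B \<in> A v \<Longrightarrow> r v B \<in> B"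
    and V: "\<And>v B. v \<in> X \<Longrightarrow> B \<in> A v \<Longrightarrow> V v \<le> of_int (w (v, r v B)) + V (r v B)"
    and V_nonpos: "\<And>v. V v \<le> (0 :: real)"
    using uniform_potential by blast
  \<comment> \<open>Maximizer's answers are the representatives of the blocks; disjointness of the
    blocks keeps any second one out of a block.\<close>
  define W where "W v = r v ` \<Lambda> v" for v
  have r\<Lambda>: "r v B \<in> B" if "v \<in> Vmax" "B \<in> \<Lambda> v" for v B
    using r[of v B] that by (simp add: X_def A_def)
  have "is_copy Vmax \<Lambda> (PiE Vmax W)"
    unfolding is_copy_def
  proof (intro exI conjI ballI)
    fix v assume v: "v \<in> Vmax"
    show "W v \<subseteq> \<Union>(\<Lambda> v)"
      using r\<Lambda>[OF v] by (auto simp: W_def)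
    fix B assume B: "B \<in> \<Lambda> v"
    have "B' = B" if "B' \<in> \<Lambda> v" "r v B' \<in> B" for B'
      using disjointD[OF partition_onD2[OF partition[OF v]] that(1) B] r\<Lambda>[OF v that(1)] that(2)
      by blast
    then show "\<exists>!x. x \<in> W v \<inter> B"
      using B r\<Lambda>[OF v B] by (intro ex1I[of _ "r v B"]) (auto simp: W_def)
  qed simp
  moreover have "PiE Vmax W \<subseteq> ?\<Sigma>"
  proof
    fix \<sigma> assume \<sigma>: "\<sigma> \<in> PiE Vmax W"
    have "W v \<subseteq> successors E v" if "v \<in> Vmax" for v
      using r\<Lambda>[OF that] partition_onD1[OF partition[OF that]] by (auto simp: W_def)
    with \<sigma> have "\<sigma> \<in> positional_strategies Vmax E"
      by (auto simp: positional_strategies_def PiE_iff)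
    moreover have "0 \<le> outcome w p" if p: "play_from E v p" "consistent Vmax \<sigma> p" for v p
    proof (rule outcome_nonneg_if_potential[OF _ V_nonpos])
      fix k
      have edge: "(p k, p (Suc k)) \<in> E"
        using p(1) by (simp add: play_from_def)
      then have X: "p k \<in> X"
        using edges by (auto simp: X_def)
      \<comment> \<open>Every move is an answer to some block: at Maximizer's vertices because
        \<open>\<sigma>\<close> takes values in \<open>W\<close>, at Minimizer's by the singleton of
        the move made. So \<open>V\<close> is a potential along the whole play.\<close>
      obtain B where B: "B \<in> A (p k)" "r (p k) B = p (Suc k)"
      proof (cases "p k \<in> Vmax")
        case True
        then have "p (Suc k) \<in> W (p k)"
          using \<sigma> p(2) by (auto simp: consistent_def)
        then show thesis
          using that True by (auto simp: W_def A_def)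
      next
        case False
        then have "{p (Suc k)} \<in> A (p k)"
          using edge by (auto simp: A_def successors_def)
        then show thesis
          using that r[OF X] by blast
      qed
      show "V (p k) \<le> of_int (w (p k, p (Suc k))) + V (p (Suc k))"
        using V[OF X B(1)] B(2) by simp
    qed
    ultimately show "\<sigma> \<in> ?\<Sigma>"
      by (auto simp: nonneg_strategies_def)
  qed
  ultimately show "strongly_shattered Vmax \<Lambda> ?\<Sigma>"
    unfolding strongly_shattered_def by blast
qed

end
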